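(* Let $a$ be a positive integer. Then $$f\left(\frac{\langle a,a+1\rangle}{5}\right)=\begin{cases}\frac{a^2}{5}-a-1 & \text{if } a\equiv 0 \pmod 5,\\[2pt] \frac{a^2-3a-3}{5} & \text{if } a\equiv 1,2 \pmod 5,\\[2pt] \frac{a^2-a-1}{5} & \text{if } a\equiv 3 \pmod 5,\\[2pt] \frac{a^2-1}{5}-a & \text{if } a\equiv 4 \pmod 5.\end{cases}$$
   Context: $\mathbb{N}$ denotes the set of nonnegative integers. A numerical semigroup is a submonoid $S$ of $(\mathbb{N},+)$ (so $0\in S$) such that $\mathbb{N}\setminus S$ is finite. The Frobenius number $f(S)$ is the largest integer not belonging to $S$ (so $f(\mathbb{N})=-1$). $\langle a,a+1\rangle=\{\lambda a+\mu(a+1)\mid \lambda,\mu\in\mathbb{N}\}$, which is a numerical semigroup. The quotient of a numerical semigroup $S$ by $5$ is the numerical semigroup $\frac{S}{5}=\{s\in\mathbb{N}\mid 5s\in S\}$. *)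

theory Defs
  imports Complex_Main "HOL-Number_Theory.Cong"
begin

definition numerical_semigroup :: "nat set \<Rightarrow> bool" where
  "numerical_semigroup S \<longleftrightarrow>
     0 \<in> S \<and> (\<forall>x\<in>S. \<forall>y\<in>S. x + y \<in> S) \<and> finite (UNIV - S)"

text \<open>The maximum is taken over all integers, so that the Frobenius number of
  \<^term>\<open>UNIV :: nat set\<close> is \<^term>\<open>- 1 :: int\<close>. It exists for every numerical semigroup
  (\<open>frobenius_number_greatest\<close> below).\<close>

definition frobenius_number :: "nat set \<Rightarrow> int" where
  "frobenius_number S = (GREATEST x :: int. x \<notin> int ` S)"

definition gen2 :: "nat \<Rightarrow> nat \<Rightarrow> nat set" where
  "gen2 a b = {l * a + m * b | l m :: nat. True}"

definition quotient_semigroup :: "nat set \<Rightarrow> nat \<Rightarrow> nat set" where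
  "quotient_semigroup S d = {s. d * s \<in> S}"

lemma frobenius_number_greatest:
  assumes "numerical_semigroup S"
  shows "frobenius_number S \<notin> int ` S"
    and "x \<notin> int ` S \<Longrightarrow> x \<le> frobenius_number S"
proof -
  define M where "M = Max (insert (- 1) (int ` (UNIV - S)))"
  have fin: "finite (insert (- 1) (int ` (UNIV - S)))"
    using assms by (simp add: numerical_semigroup_def)
  have "M \<in> insert (- 1) (int ` (UNIV - S))"
    unfolding M_def using fin by (intro Max_in) auto
  hence 1: "M \<notin> int ` S" by auto
  have 2: "y \<le> M" if "y \<notin> int ` S" for y
  proof (cases "y < 0")
    case True
    moreover have "- 1 \<le> M" unfolding M_def using fin by (intro Max_ge) auto
    ultimately show ?thesis by simp
  next
    case False
    then obtain n where n: "y = int n" by (metis nonneg_int_cases not_less)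
    with that have "y \<in> int ` (UNIV - S)" by auto
    thus ?thesis unfolding M_def using fin by (intro Max_ge) auto
  qed
  have "frobenius_number S = M"
    unfolding frobenius_number_def by (intro Greatest_equality) (use 1 2 in auto)
  with 1 2 show "frobenius_number S \<notin> int ` S"
    and "x \<notin> int ` S \<Longrightarrow> x \<le> frobenius_number S" by auto
qed

lemma numerical_semigroup_gen2_Suc:
  assumes "a > 0"
  shows "numerical_semigroup (gen2 a (a + 1))"
proof -
  have "n \<in> gen2 a (a + 1)" if "a * a \<le> n" for n
  proof -
    have "a \<le> n div a" using that assms by (simp add: less_eq_div_iff_mult_less_eq)
    moreover have "n mod a < a" using assms by simp
    ultimately obtain k where k: "n div a = n mod a + k"
      by (metis le_iff_add less_imp_le order_trans)
    have "n = (n div a) * a + n mod a" by simp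
    also have "\<dots> = k * a + (n mod a) * (a + 1)"
      unfolding k by (simp add: algebra_simps)
    finally show ?thesis unfolding gen2_def by blast
  qed
  hence "UNIV - gen2 a (a + 1) \<subseteq> {..<a * a}" by (auto simp: not_less[symmetric])
  hence "finite (UNIV - gen2 a (a + 1))" using finite_subset by blast
  moreover have "0 \<in> gen2 a (a + 1)" unfolding gen2_def by force
  moreover have "x + y \<in> gen2 a (a + 1)"
    if xy: "x \<in> gen2 a (a + 1)" "y \<in> gen2 a (a + 1)" for x y
  proof -
    obtain l m l' m' where "x = l * a + m * (a + 1)" "y = l' * a + m' * (a + 1)"
      using xy unfolding gen2_def by blast
    hence "x + y = (l + l') * a + (m + m') * (a + 1)" by (simp add: algebra_simps)
    thus ?thesis unfolding gen2_def by blast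
  qed
  ultimately show ?thesis unfolding numerical_semigroup_def by blast
qed

lemma numerical_semigroup_quotient:
  assumes "numerical_semigroup S" and "d > 0"
  shows "numerical_semigroup (quotient_semigroup S d)"
proof -
  have "inj_on ((*) d) (UNIV - quotient_semigroup S d)"
    using assms(2) by (auto simp: inj_on_def)
  moreover have "(*) d ` (UNIV - quotient_semigroup S d) \<subseteq> UNIV - S"
    by (auto simp: quotient_semigroup_def)
  ultimately have "finite (UNIV - quotient_semigroup S d)"
    using assms(1) unfolding numerical_semigroup_def by (meson inj_on_finite)
  with assms(1) show ?thesis
    by (auto simp: numerical_semigroup_def quotient_semigroup_def distrib_left)
qed

end

theory Submission
  imports Defs
begin

text \<open>
  The integers outside \<open>\<langle>a, a + 1\<rangle>\<close> are exactly the numbers \<open>a\<^sup>2 - (j a + i)\<close> with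
  \<open>1 \<le> i \<le> j\<close> (\<open>not_in_gen2_Suc_iff\<close>): between the block of sums of \<open>q\<close> generators, which is
  \<open>[q a, q a + q]\<close>, and the block of sums of \<open>q + 1\<close> generators there is, for
  \<open>0 \<le> q \<le> a - 2\<close>, a gap of length \<open>j = a - 1 - q\<close> ending just below \<open>(q + 1) a = a\<^sup>2 - j a\<close>.
  Letting \<open>j\<close> exceed \<open>a - 1\<close> accounts for the negative integers, so that a Frobenius number
  equal to \<open>-1\<close> needs no separate treatment.

  Since \<open>x\<close> lies outside the quotient by \<open>d\<close> iff \<open>d x\<close> lies outside the semigroup, \<open>d\<close> times
  the Frobenius number of the quotient is obtained by minimising \<open>j a + i\<close> over the pairs
  \<open>1 \<le> i \<le> j\<close> for which \<open>d\<close> divides \<open>a\<^sup>2 - j a - i\<close> (\<open>frobenius_quotient_gen2_Suc\<close>).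
  For \<open>d = 5\<close> the divisibility depends only on \<open>a mod 5\<close>, and the minimising pairs \<open>(j, i)\<close> for
  the residues \<open>0, 1, 2, 3, 4\<close> are \<open>(5, 5)\<close>, \<open>(3, 3)\<close>, \<open>(3, 3)\<close>, \<open>(1, 1)\<close>, \<open>(5, 1)\<close>.
\<close>

text \<open>
  If \<open>x = l a + m (a + 1)\<close> were \<open>a\<^sup>2 - j a - i\<close>, then \<open>a\<close> would divide \<open>m + i > 0\<close>, so that
  \<open>a \<le> m + i \<le> m + j\<close>; but cancelling \<open>a\<close> gives \<open>l + m + j = a - (m + i) / a < a\<close>. Conversely,
  \<open>x = q a + r\<close> with \<open>0 \<le> r < a\<close> is a sum of \<open>q\<close> generators as soon as \<open>r \<le> q\<close>; otherwise
  \<open>j = a - 1 - q\<close> and \<open>i = a - r\<close> fit.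
\<close>

lemma not_in_gen2_Suc_iff:
  fixes a :: nat and x :: int
  assumes "a > 0"
  shows "x \<notin> int ` gen2 a (a + 1) \<longleftrightarrow>
    (\<exists>i j. 1 \<le> i \<and> i \<le> j \<and> x = (int a)\<^sup>2 - (j * int a + i))"
proof
  assume x: "x \<notin> int ` gen2 a (a + 1)"
  define q r where "q = x div int a" and "r = x mod int a"
  have r: "0 \<le> r" "r < int a" and qr: "x = q * int a + r"
    using assms by (auto simp: q_def r_def)
  have "q < r"
  proof (rule ccontr)
    assume "\<not> q < r"
    then have "x = int (nat (q - r) * a + nat r * (a + 1))"
      using r by (simp add: qr algebra_simps)
    with x show False unfolding gen2_def by blast
  qed
  moreover have "x = (int a)\<^sup>2 - ((int a - 1 - q) * int a + (int a - r))"
    by (simp add: qr algebra_simps power2_eq_square)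
  ultimately show "\<exists>i j. 1 \<le> i \<and> i \<le> j \<and> x = (int a)\<^sup>2 - (j * int a + i)"
    using r by (intro exI[of _ "int a - r"] exI[of _ "int a - 1 - q"]) auto
next
  assume "\<exists>i j. 1 \<le> i \<and> i \<le> j \<and> x = (int a)\<^sup>2 - (j * int a + i)"
  then obtain i j where ij: "1 \<le> i" "i \<le> j" and x: "x = (int a)\<^sup>2 - (j * int a + i)"
    by blast
  show "x \<notin> int ` gen2 a (a + 1)"
  proof
    assume "x \<in> int ` gen2 a (a + 1)"
    then obtain l m where lm: "x = int (l * a + m * (a + 1))"
      unfolding gen2_def by blast
    have eq: "int m + i = (int a - int l - int m - j) * int a"
      using lm x by (simp add: algebra_simps power2_eq_square)
    define t where "t = int a - int l - int m - j"
    have "0 < t * int a" using eq ij by (simp add: t_def)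
    then have t: "1 \<le> t" using assms by (simp add: zero_less_mult_iff)
    have "int a \<le> int m + i" using mult_right_mono[OF t, of "int a"] by (simp add: eq t_def)
    with t ij show False unfolding t_def by linarith
  qed
qed

lemma in_quotient_semigroup_iff:
  assumes "d > 0"
  shows "x \<in> int ` quotient_semigroup S d \<longleftrightarrow> int d * x \<in> int ` S"
proof
  assume "x \<in> int ` quotient_semigroup S d"
  then show "int d * x \<in> int ` S"
    unfolding quotient_semigroup_def by (auto simp flip: of_nat_mult)
next
  assume *: "int d * x \<in> int ` S"
  then have "0 \<le> int d * x" by auto
  then have "0 \<le> x" using assms by (simp add: zero_le_mult_iff)
  then obtain n where n: "x = int n" by (metis nonneg_int_cases)
  with * have "d * n \<in> S" by (metis imageE of_nat_eq_iff of_nat_mult)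
  then show "x \<in> int ` quotient_semigroup S d"
    by (simp add: n quotient_semigroup_def)
qed

lemma frobenius_quotient_gen2_Suc:
  fixes a d :: nat and i0 j0 :: int
  assumes "a > 0" "d > 0"
    and ij0: "1 \<le> i0" "i0 \<le> j0" "int d dvd (int a)\<^sup>2 - (j0 * int a + i0)"
    and minimal: "\<And>i j. 1 \<le> i \<Longrightarrow> i \<le> j \<Longrightarrow> int d dvd (int a)\<^sup>2 - (j * int a + i) \<Longrightarrow>
      j0 * int a + i0 \<le> j * int a + i"
  shows "int d * frobenius_number (quotient_semigroup (gen2 a (a + 1)) d) =
    (int a)\<^sup>2 - (j0 * int a + i0)"
proof -
  let ?Q = "quotient_semigroup (gen2 a (a + 1)) d"
  obtain F where F: "(int a)\<^sup>2 - (j0 * int a + i0) = int d * F"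
    using ij0(3) by (rule dvdE)
  have out: "x \<notin> int ` ?Q \<longleftrightarrow>
      (\<exists>i j. 1 \<le> i \<and> i \<le> j \<and> int d * x = (int a)\<^sup>2 - (j * int a + i))" for x
    using in_quotient_semigroup_iff[OF \<open>d > 0\<close>] not_in_gen2_Suc_iff[OF \<open>a > 0\<close>] by simp
  have "frobenius_number ?Q = F"
    unfolding frobenius_number_def
  proof (rule Greatest_equality)
    show "F \<notin> int ` ?Q" unfolding out using ij0(1,2) F by metis
  next
    fix x assume "x \<notin> int ` ?Q"
    then obtain i j where ij: "1 \<le> i" "i \<le> j" "int d * x = (int a)\<^sup>2 - (j * int a + i)"
      unfolding out by blast
    then have "int d dvd (int a)\<^sup>2 - (j * int a + i)" by (metis dvd_triv_left)
    from minimal[OF ij(1,2) this] have "int d * x \<le> int d * F" using ij(3) F by linarith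
    then show "x \<le> F" using \<open>d > 0\<close> by simp
  qed
  with F show ?thesis by simp
qed

text \<open>Once \<open>a\<close> is replaced by a numeral residue, the divisibility condition on \<open>i\<close> and \<open>j\<close> is
  linear and therefore decidable by Presburger arithmetic.\<close>

lemma dvd_square_minus_mod:
  fixes a i j d :: int
  shows "d dvd a\<^sup>2 - (j * a + i) \<longleftrightarrow> d dvd (a mod d)\<^sup>2 - (j * (a mod d) + i)"
proof -
  have "[a = a mod d] (mod d)" by (simp add: cong_def)
  then have "[a\<^sup>2 - (j * a + i) = (a mod d)\<^sup>2 - (j * (a mod d) + i)] (mod d)"
    by (intro cong_diff cong_add cong_mult cong_pow cong_refl)
  then show ?thesis by (simp add: cong_dvd_iff)
qed

lemma mult_add_mono:
  fixes a i i0 j j0 :: int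
  assumes "0 \<le> a" "j0 \<le> j" "i0 \<le> i"
  shows "j0 * a + i0 \<le> j * a + i"
  using assms by (simp add: add_mono mult_right_mono)

theorem corollary4p8:
  fixes a :: nat
  assumes "a > 0"
  defines "F \<equiv> real_of_int (frobenius_number (quotient_semigroup (gen2 a (a + 1)) 5))"
  shows "([a = 0] (mod 5) \<longrightarrow> F = (real a)\<^sup>2 / 5 - real a - 1) \<and>
    ([a = 1] (mod 5) \<or> [a = 2] (mod 5) \<longrightarrow> F = ((real a)\<^sup>2 - 3 * real a - 3) / 5) \<and>
    ([a = 3] (mod 5) \<longrightarrow> F = ((real a)\<^sup>2 - real a - 1) / 5) \<and>
    ([a = 4] (mod 5) \<longrightarrow> F = ((real a)\<^sup>2 - 1) / 5 - real a)"
proof -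
  have F: "5 * F = (real a)\<^sup>2 - (real_of_int j0 * real a + real_of_int i0)"
    if ij0: "1 \<le> i0" "i0 \<le> j0" and r: "int a mod 5 = r" "5 dvd r\<^sup>2 - (j0 * r + i0)"
      and minimal: "\<And>i j. 1 \<le> i \<Longrightarrow> i \<le> j \<Longrightarrow> 5 dvd r\<^sup>2 - (j * r + i) \<Longrightarrow>
        j0 * int a + i0 \<le> j * int a + i"
    for i0 j0 r :: int
  proof -
    have "5 * frobenius_number (quotient_semigroup (gen2 a (a + 1)) 5) =
        (int a)\<^sup>2 - (j0 * int a + i0)"
      using frobenius_quotient_gen2_Suc[OF \<open>a > 0\<close>, of 5 i0 j0] ij0 r(2) minimal
      unfolding dvd_square_minus_mod[of _ "int a"] by (simp add: r(1))
    from arg_cong[OF this, of real_of_int] show ?thesis by (simp add: F_def)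
  qed
  have mod5: "[a = k] (mod 5) \<Longrightarrow> k < 5 \<Longrightarrow> int a mod 5 = int k" for k
    by (simp add: cong_def) (metis zmod_int of_nat_numeral)
  have c0: "F = (real a)\<^sup>2 / 5 - real a - 1" if "[a = 0] (mod 5)"
  proof -
    have "5 * F = (real a)\<^sup>2 - (real_of_int 5 * real a + real_of_int 5)"
    proof (rule F[where r = 0])
      show "int a mod 5 = 0" using mod5[OF that] by simp
      fix i j :: int
      assume "1 \<le> i" "i \<le> j" "5 dvd 0\<^sup>2 - (j * 0 + i)"
      then have "5 \<le> i" "5 \<le> j" by (simp_all, presburger+)
      then show "5 * int a + 5 \<le> j * int a + i" by (intro mult_add_mono) auto
    qed auto
    then show ?thesis by (simp add: field_simps)
  qed
  have c12: "F = ((real a)\<^sup>2 - 3 * real a - 3) / 5" if "[a = 1] (mod 5) \<or> [a = 2] (mod 5)"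
  proof -
    from that obtain r :: int where r: "int a mod 5 = r" "r = 1 \<or> r = 2"
      using mod5[of 1] mod5[of 2] by auto
    have "5 * F = (real a)\<^sup>2 - (real_of_int 3 * real a + real_of_int 3)"
    proof (rule F[OF _ _ r(1)])
      show "5 dvd r\<^sup>2 - (3 * r + 3)" using r(2) by auto
      fix i j :: int
      assume ij: "1 \<le> i" "i \<le> j" "5 dvd r\<^sup>2 - (j * r + i)"
      then have "j = 3 \<and> 3 \<le> i \<or> 4 \<le> j"
        using r(2) by (elim disjE) (simp_all, presburger+)
      then consider "j = 3" "3 \<le> i" | "4 \<le> j" "2 \<le> a" | "4 \<le> j" "a = 1"
        using \<open>a > 0\<close> by linarith
      then show "3 * int a + 3 \<le> j * int a + i"
      proof cases
        case 2
        then have "4 * int a + 1 \<le> j * int a + i" using ij by (intro mult_add_mono) auto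
        with 2 show ?thesis by simp
      next
        \<comment> \<open>Here increasing \<open>j\<close> by one gains too little to make up for \<open>i = 1\<close>, but the
          congruence forces \<open>j + i \<equiv> 1\<close> modulo 5.\<close>
        case 3
        with r ij have "5 dvd 1 - (j + i)" by auto
        with ij have "6 \<le> j + i" by presburger
        with 3 show ?thesis by simp
      qed simp
    qed auto
    then show ?thesis by (simp add: field_simps)
  qed
  have c3: "F = ((real a)\<^sup>2 - real a - 1) / 5" if "[a = 3] (mod 5)"
  proof -
    have "5 * F = (real a)\<^sup>2 - (real_of_int 1 * real a + real_of_int 1)"
    proof (rule F[where r = 3])
      show "int a mod 5 = 3" using mod5[OF that] by simp
      fix i j :: int
      assume "1 \<le> i" "i \<le> j"
      then show "1 * int a + 1 \<le> j * int a + i" by (intro mult_add_mono) auto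
    qed auto
    then show ?thesis by (simp add: field_simps)
  qed
  have c4: "F = ((real a)\<^sup>2 - 1) / 5 - real a" if "[a = 4] (mod 5)"
  proof -
    have "5 * F = (real a)\<^sup>2 - (real_of_int 5 * real a + real_of_int 1)"
    proof (rule F[where r = 4])
      show "int a mod 5 = 4" using mod5[OF that] by simp
      fix i j :: int
      assume ij: "1 \<le> i" "i \<le> j" "5 dvd 4\<^sup>2 - (j * 4 + i)"
      then have "5 \<le> j" by (simp, presburger)
      with ij show "5 * int a + 1 \<le> j * int a + i" by (intro mult_add_mono) auto
    qed auto
    then show ?thesis by (simp add: field_simps)
  qed
  show ?thesis using c0 c12 c3 c4 by blast
qed

end
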